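(* Let $J$ be a finite-dimensional unital Jordan algebra over $\mathbb{R}$ and let $M=J\otimes E$ be a free module over $J$, where $E$ is a finite-dimensional real vector space. Then any (derivation-based) connection $\nabla$ on $M$ is of the form $$\nabla=\nabla^0+\mathcal{A},$$ where $\nabla^0$ is the base connection $\nabla^0_X(x\otimes e)=X(x)\otimes e$ and $\mathcal{A}:Der(J)\rightarrow Z(J)\otimes End(E)$ is a linear map, with $\mathcal{A}(X)$ acting on $M$ by $$\mathcal{A}(X)(x\otimes e)=x\otimes \mathcal{A}(X)e$$ for all $X\in Der(J)$, $x\in J$, $e\in E$; here an element $z\otimes T\in Z(J)\otimes End(E)$ acts on $J\otimes E$ by $(z\otimes T)(x\otimes e)=(zx)\otimes Te$.
   Context: A (real) Jordan algebra is a real vector space $J$ with a bilinear commutative product satisfying $x(yx^2)=(xy)x^2$ for all $x,y\in J$. With $[x,y,z]=(xy)z-x(yz)$, its center $Z(J)$ is the set of $z\in J$ with $[x,y,z]=[x,z,y]=[z,x,y]=0$ for all $x,y\in J$. $Der(J)$ is the Lie algebra of derivations of $J$; it is a $Z(J)$-module by $(zX)(x)=zX(x)$. A free $J$-module is $J\otimes E$ (tensor product over $\mathbb{R}$), with $E$ a finite-dimensional real vector space and action $y(x\otimes e)=(yx)\otimes e$. A derivation-based connection on a $J$-module $M$ is a linear map $\nabla:Der(J)\to End(M)$, $X\mapsto\nabla_X$ (with $End(M)$ the linear endomorphisms of $M$), such that $\nabla_X(xm)=X(x)m+x\nabla_Xm$ and $\nabla_{zX}(m)=z\nabla_X(m)$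 for all $X\in Der(J)$, $x\in J$, $m\in M$, $z\in Z(J)$. *)

theory Defs
  imports "HOL-Analysis.Analysis" "HOL-Library.Poly_Mapping"
begin

section \<open>Tensor products of real vector spaces\<close>

text \<open>
  The tensor product is the free real vector space on pairs, modulo the span of the bilinearity
  relations; the universal property is \<open>tensor_lift_unique\<close> below.
\<close>

instantiation poly_mapping :: (type, real_vector) real_vector
begin

definition scaleR_poly_mapping :: "real \<Rightarrow> ('a \<Rightarrow>\<^sub>0 'b) \<Rightarrow> 'a \<Rightarrow>\<^sub>0 'b" where
  "scaleR_poly_mapping r = Poly_Mapping.map (scaleR r)"

lemma lookup_scaleR: "Poly_Mapping.lookup (r *\<^sub>R p) k = r *\<^sub>R Poly_Mapping.lookup p k"
  by (simp add: scaleR_poly_mapping_def map.rep_eq when_def)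

instance
  by standard
    (rule poly_mapping_eqI; simp add: lookup_scaleR lookup_add scaleR_add_right scaleR_add_left)+

end

definition tensor_relations :: "('a::real_vector \<times> 'b::real_vector \<Rightarrow>\<^sub>0 real) set" where
  "tensor_relations =
     {Poly_Mapping.single (a + a', b) 1 - Poly_Mapping.single (a, b) 1
        - Poly_Mapping.single (a', b) 1 | a a' b. True} \<union>
     {Poly_Mapping.single (a, b + b') 1 - Poly_Mapping.single (a, b) 1
        - Poly_Mapping.single (a, b') 1 | a b b'. True} \<union>
     {Poly_Mapping.single (r *\<^sub>R a, b) 1 - r *\<^sub>R Poly_Mapping.single (a, b) 1 | r a b. True} \<union>
     {Poly_Mapping.single (a, r *\<^sub>R b) 1 - r *\<^sub>R Poly_Mapping.single (a, b) 1 | r a b. True}"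

definition tensor_rel ::
  "('a::real_vector \<times> 'b::real_vector \<Rightarrow>\<^sub>0 real) \<Rightarrow> ('a \<times> 'b \<Rightarrow>\<^sub>0 real) \<Rightarrow> bool" where
  "tensor_rel p q \<longleftrightarrow> p - q \<in> span tensor_relations"

lemma equivp_tensor_rel: "equivp tensor_rel"
proof (rule equivpI)
  show "reflp tensor_rel"
    by (simp add: reflp_def tensor_rel_def span_zero)
  show "symp tensor_rel"
    unfolding symp_def tensor_rel_def by (intro allI impI, drule span_neg) simp
  show "transp tensor_rel"
    unfolding transp_def tensor_rel_def by (intro allI impI, drule (1) span_add) simp
qed

quotient_type (overloaded) ('a, 'b) tensor_product =
  "'a::real_vector \<times> 'b::real_vector \<Rightarrow>\<^sub>0 real" / tensor_rel
  by (rule equivp_tensor_rel)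

instantiation tensor_product :: (real_vector, real_vector) real_vector
begin

lift_definition zero_tensor_product :: "('a, 'b) tensor_product" is 0 .

lift_definition plus_tensor_product ::
  "('a, 'b) tensor_product \<Rightarrow> ('a, 'b) tensor_product \<Rightarrow> ('a, 'b) tensor_product" is "(+)"
  unfolding tensor_rel_def by (drule (1) span_add) (simp add: algebra_simps)

lift_definition uminus_tensor_product ::
  "('a, 'b) tensor_product \<Rightarrow> ('a, 'b) tensor_product" is uminus
  unfolding tensor_rel_def by (drule span_neg) (simp add: algebra_simps)

lift_definition minus_tensor_product ::
  "('a, 'b) tensor_product \<Rightarrow> ('a, 'b) tensor_product \<Rightarrow> ('a, 'b) tensor_product" is "(-)"
  unfolding tensor_rel_def by (drule (1) span_diff) (simp add: algebra_simps)

lift_definition scaleR_tensor_product ::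
  "real \<Rightarrow> ('a, 'b) tensor_product \<Rightarrow> ('a, 'b) tensor_product" is scaleR
  unfolding tensor_rel_def by (drule span_scale) (simp add: scaleR_diff_right)

lemma tensor_rel_refl: "p = q \<Longrightarrow> tensor_rel p q"
  by (simp add: tensor_rel_def span_zero)

instance
  by standard (transfer; rule tensor_rel_refl; simp add: algebra_simps)+

end

lift_definition tensor :: "'a::real_vector \<Rightarrow> 'b::real_vector \<Rightarrow> ('a, 'b) tensor_product"
    (infixl "\<otimes>" 75)
  is "\<lambda>a b. Poly_Mapping.single (a, b) 1" .

lemma bilinear_tensor:
  "bilinear (tensor :: 'a::real_vector \<Rightarrow> 'b::real_vector \<Rightarrow> ('a, 'b) tensor_product)"
proof -
  have "(a + a') \<otimes> b = a \<otimes> b + a' \<otimes> b" for a a' :: 'a and b :: 'b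
  proof (transfer, unfold tensor_rel_def, rule span_base)
    fix a a' :: 'a and b :: 'b
    show "Poly_Mapping.single (a + a', b) 1
      - (Poly_Mapping.single (a, b) 1 + Poly_Mapping.single (a', b) (1::real)) \<in> tensor_relations"
      unfolding tensor_relations_def diff_diff_eq[symmetric] by blast
  qed
  moreover have "a \<otimes> (b + b') = a \<otimes> b + a \<otimes> b'" for a :: 'a and b b' :: 'b
  proof (transfer, unfold tensor_rel_def, rule span_base)
    fix a :: 'a and b b' :: 'b
    show "Poly_Mapping.single (a, b + b') 1
      - (Poly_Mapping.single (a, b) 1 + Poly_Mapping.single (a, b') (1::real)) \<in> tensor_relations"
      unfolding tensor_relations_def diff_diff_eq[symmetric] by blast
  qed
  moreover have "(r *\<^sub>R a) \<otimes> b = r *\<^sub>R (a \<otimes> b)" for r and a :: 'a and b :: 'b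
  proof (transfer, unfold tensor_rel_def, rule span_base)
    fix r and a :: 'a and b :: 'b
    show "Poly_Mapping.single (r *\<^sub>R a, b) 1
      - r *\<^sub>R Poly_Mapping.single (a, b) (1::real) \<in> tensor_relations"
      unfolding tensor_relations_def by blast
  qed
  moreover have "a \<otimes> (r *\<^sub>R b) = r *\<^sub>R (a \<otimes> b)" for r and a :: 'a and b :: 'b
  proof (transfer, unfold tensor_rel_def, rule span_base)
    fix r and a :: 'a and b :: 'b
    show "Poly_Mapping.single (a, r *\<^sub>R b) 1
      - r *\<^sub>R Poly_Mapping.single (a, b) (1::real) \<in> tensor_relations"
      unfolding tensor_relations_def by blast
  qed
  ultimately show ?thesis
    by (simp add: bilinear_def linear_iff)
qed

lemma poly_mapping_expand:
  fixes p :: "'k \<Rightarrow>\<^sub>0 real"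
  shows "p = (\<Sum>k\<in>Poly_Mapping.keys p. Poly_Mapping.lookup p k *\<^sub>R Poly_Mapping.single k 1)"
proof (rule poly_mapping_eqI)
  fix j
  have "finite I \<Longrightarrow> Poly_Mapping.lookup (\<Sum>i\<in>I. Poly_Mapping.lookup p i *\<^sub>R Poly_Mapping.single i 1) j
      = (if j \<in> I then Poly_Mapping.lookup p j else 0)" for I
    by (induction I rule: finite_induct)
      (auto simp: lookup_single lookup_add lookup_scaleR when_def)
  from this[of "Poly_Mapping.keys p"]
  show "Poly_Mapping.lookup p j = Poly_Mapping.lookup (\<Sum>k\<in>Poly_Mapping.keys p. Poly_Mapping.lookup p k *\<^sub>R Poly_Mapping.single k 1) j"
    by (simp add: in_keys_iff)
qed

lemma linear_abs_tensor_product: "linear abs_tensor_product"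
  by (rule linearI) (simp_all add: plus_tensor_product.abs_eq scaleR_tensor_product.abs_eq)

lemma tensor_expand:
  fixes p :: "'a::real_vector \<times> 'b::real_vector \<Rightarrow>\<^sub>0 real"
  shows "abs_tensor_product p = (\<Sum>k\<in>Poly_Mapping.keys p. Poly_Mapping.lookup p k *\<^sub>R (fst k \<otimes> snd k))"
proof -
  have "abs_tensor_product p
      = abs_tensor_product (\<Sum>k\<in>Poly_Mapping.keys p. Poly_Mapping.lookup p k *\<^sub>R Poly_Mapping.single k 1)"
    by (subst poly_mapping_expand[of p]) simp
  also have "\<dots> = (\<Sum>k\<in>Poly_Mapping.keys p. Poly_Mapping.lookup p k *\<^sub>R
      abs_tensor_product (Poly_Mapping.single k 1))"
    by (simp add: linear_sum[OF linear_abs_tensor_product]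
        linear_scale[OF linear_abs_tensor_product])
  finally show ?thesis
    by (simp add: tensor.abs_eq)
qed

lemma span_tensors: "span {a \<otimes> b | a b. True} = UNIV"
proof -
  have "t \<in> span {a \<otimes> b | a b. True}" for t :: "('a::real_vector, 'b::real_vector) tensor_product"
  proof -
    obtain p where t: "t = abs_tensor_product p"
      using Quotient3_abs_rep[OF Quotient3_tensor_product] by metis
    show ?thesis
      unfolding t tensor_expand
      by (intro span_sum span_scale span_base) auto
  qed
  then show ?thesis by auto
qed

lemma tensor_eqI:
  fixes g h :: "('a::real_vector, 'b::real_vector) tensor_product \<Rightarrow> 'c::real_vector"
  assumes "linear g" "linear h" "\<And>a b. g (a \<otimes> b) = h (a \<otimes> b)"
  shows "g = h"
proof
  fix t :: "('a, 'b) tensor_product"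
  have "t \<in> span {a \<otimes> b | a b. True}"
    unfolding span_tensors by (rule UNIV_I)
  then show "g t = h t"
    by (rule linear_eq_on[OF assms(1,2)]) (use assms(3) in auto)
qed

theorem tensor_lift_unique:
  fixes f :: "'a::real_vector \<Rightarrow> 'b::real_vector \<Rightarrow> 'c::real_vector"
  assumes f: "bilinear f"
  shows "\<exists>!h. linear h \<and> (\<forall>a b. h (a \<otimes> b) = f a b)"
proof (rule ex_ex1I)
  define F :: "('a \<times> 'b \<Rightarrow>\<^sub>0 real) \<Rightarrow> 'c" where
    "F p = (\<Sum>k\<in>Poly_Mapping.keys p. Poly_Mapping.lookup p k *\<^sub>R f (fst k) (snd k))" for p
  have F_super: "F p = (\<Sum>k\<in>K. Poly_Mapping.lookup p k *\<^sub>R f (fst k) (snd k))"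
    if "finite K" "Poly_Mapping.keys p \<subseteq> K" for p :: "'a \<times> 'b \<Rightarrow>\<^sub>0 real" and K
    unfolding F_def by (rule sum.mono_neutral_left) (use that in \<open>auto simp: in_keys_iff\<close>)
  have lin: "linear F"
  proof (rule linearI)
    fix p q :: "'a \<times> 'b \<Rightarrow>\<^sub>0 real"
    let ?K = "Poly_Mapping.keys p \<union> Poly_Mapping.keys q"
    have "F (p + q) = (\<Sum>k\<in>?K. Poly_Mapping.lookup (p + q) k *\<^sub>R f (fst k) (snd k))"
      by (rule F_super) (auto simp: in_keys_iff lookup_add)
    also have "\<dots> = F p + F q"
      using F_super[of ?K p] F_super[of ?K q]
      by (simp add: lookup_add scaleR_add_left sum.distrib)
    finally show "F (p + q) = F p + F q" .
  next
    fix r and p :: "'a \<times> 'b \<Rightarrow>\<^sub>0 real"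
    have "F (r *\<^sub>R p) = (\<Sum>k\<in>Poly_Mapping.keys p. Poly_Mapping.lookup (r *\<^sub>R p) k *\<^sub>R f (fst k) (snd k))"
      by (rule F_super) (auto simp: in_keys_iff lookup_scaleR)
    then show "F (r *\<^sub>R p) = r *\<^sub>R F p"
      by (simp add: F_def lookup_scaleR scaleR_sum_right)
  qed
  have F_single: "F (Poly_Mapping.single (a, b) 1) = f a b" for a b
    by (simp add: F_def)
  have "F p = 0" if "p \<in> tensor_relations" for p
    using that unfolding tensor_relations_def
    by (auto simp: linear_diff[OF lin] linear_scale[OF lin] F_single bilinear_ladd[OF f]
        bilinear_radd[OF f] bilinear_lmul[OF f] bilinear_rmul[OF f])
  then have F0: "F p = 0" if "p \<in> span tensor_relations" for p
    using linear_eq_0_on_span[OF lin _ that] by blast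
  have F_cong: "F p = F q" if "tensor_rel p q" for p q
    using F0[of "p - q"] that by (simp add: tensor_rel_def linear_diff[OF lin])
  have rep: "F (rep_tensor_product (abs_tensor_product p)) = F p" for p
    by (rule F_cong, rule Quotient3_rep_abs[OF Quotient3_tensor_product])
      (rule equivp_reflp[OF equivp_tensor_rel])
  have "linear (\<lambda>t. F (rep_tensor_product t))"
  proof (rule linearI)
    fix s t :: "('a, 'b) tensor_product"
    obtain p q where st: "s = abs_tensor_product p" "t = abs_tensor_product q"
      using Quotient3_abs_rep[OF Quotient3_tensor_product] by metis
    have "s + t = abs_tensor_product (p + q)"
      by (simp add: st linear_add[OF linear_abs_tensor_product])
    then show "F (rep_tensor_product (s + t)) = F (rep_tensor_product s) + F (rep_tensor_product t)"
      by (simp only: st rep linear_add[OF lin])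
  next
    fix r and t :: "('a, 'b) tensor_product"
    obtain p where t: "t = abs_tensor_product p"
      using Quotient3_abs_rep[OF Quotient3_tensor_product] by metis
    have "r *\<^sub>R t = abs_tensor_product (r *\<^sub>R p)"
      by (simp add: t linear_scale[OF linear_abs_tensor_product])
    then show "F (rep_tensor_product (r *\<^sub>R t)) = r *\<^sub>R F (rep_tensor_product t)"
      by (simp only: t rep linear_scale[OF lin])
  qed
  moreover have "F (rep_tensor_product (a \<otimes> b)) = f a b" for a b
    by (simp only: tensor.abs_eq rep F_single)
  ultimately show "\<exists>h. linear h \<and> (\<forall>a b. h (a \<otimes> b) = f a b)"
    by blast
next
  fix g h :: "('a, 'b) tensor_product \<Rightarrow> 'c"
  assume "linear g \<and> (\<forall>a b. g (a \<otimes> b) = f a b)" "linear h \<and> (\<forall>a b. h (a \<otimes> b) = f a b)"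
  then show "g = h"
    by (auto intro: tensor_eqI)
qed

text \<open>The following is only meaningful for bilinear \<open>f\<close>.\<close>

definition tensor_lift ::
  "('a::real_vector \<Rightarrow> 'b::real_vector \<Rightarrow> 'c::real_vector) \<Rightarrow> ('a, 'b) tensor_product \<Rightarrow> 'c" where
  "tensor_lift f = (THE h. linear h \<and> (\<forall>a b. h (a \<otimes> b) = f a b))"

lemma
  assumes "bilinear f"
  shows linear_tensor_lift: "linear (tensor_lift f)"
    and tensor_lift_tensor: "tensor_lift f (a \<otimes> b) = f a b"
  using theI'[OF tensor_lift_unique[OF assms]] unfolding tensor_lift_def by blast+


section \<open>The space of linear endomorphisms\<close>

typedef (overloaded) 'a endo = "{f :: 'a::real_vector \<Rightarrow> 'a. linear f}"
  morphisms endo_apply Abs_endo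
  by (intro exI[of _ "\<lambda>_. 0"]) (simp add: linear_iff)

setup_lifting type_definition_endo

instantiation endo :: (real_vector) real_vector
begin

lift_definition zero_endo :: "'a endo" is "\<lambda>_. 0"
  by (simp add: linear_iff)

lift_definition plus_endo :: "'a endo \<Rightarrow> 'a endo \<Rightarrow> 'a endo" is "\<lambda>f g x. f x + g x"
  by (rule linear_compose_add)

lift_definition uminus_endo :: "'a endo \<Rightarrow> 'a endo" is "\<lambda>f x. - f x"
  by (rule linear_compose_neg)

lift_definition minus_endo :: "'a endo \<Rightarrow> 'a endo \<Rightarrow> 'a endo" is "\<lambda>f g x. f x - g x"
  by (rule linear_compose_sub)

lift_definition scaleR_endo :: "real \<Rightarrow> 'a endo \<Rightarrow> 'a endo" is "\<lambda>r f x. r *\<^sub>R f x"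
  by (rule linear_compose_scale_right)

instance
  by standard (transfer; simp add: fun_eq_iff algebra_simps)+

end

lemma linear_endo_apply: "linear (endo_apply f)"
  using endo_apply by blast


section \<open>Jordan algebras\<close>

class jordan_algebra = real_vector + times +
  assumes jordan_commute: "x * y = y * x"
    and jordan_add_left: "(x + y) * z = x * z + y * z"
    and jordan_scaleR_left: "(r *\<^sub>R x) * y = r *\<^sub>R (x * y)"
    and jordan_identity: "x * (y * (x * x)) = (x * y) * (x * x)"

class unital_jordan_algebra = jordan_algebra + one +
  assumes jordan_one_left: "1 * x = x"

lemma bilinear_jordan_times: "bilinear ((*) :: 'a \<Rightarrow> 'a \<Rightarrow> 'a::jordan_algebra)"
proof -
  have "x * (y + z) = x * y + x * z" "x * (r *\<^sub>R y) = r *\<^sub>R (x * y)" for x y z :: 'a and r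
    by (metis jordan_commute jordan_add_left) (metis jordan_commute jordan_scaleR_left)
  then show ?thesis
    by (simp add: bilinear_def linear_iff jordan_add_left jordan_scaleR_left)
qed

lemmas jordan_simps =
  jordan_add_left jordan_scaleR_left
  bilinear_radd[OF bilinear_jordan_times] bilinear_rmul[OF bilinear_jordan_times]
  bilinear_lsub[OF bilinear_jordan_times] bilinear_rsub[OF bilinear_jordan_times]
  bilinear_lneg[OF bilinear_jordan_times] bilinear_rneg[OF bilinear_jordan_times]
  bilinear_lzero[OF bilinear_jordan_times] bilinear_rzero[OF bilinear_jordan_times]

definition associator :: "'a::jordan_algebra \<Rightarrow> 'a \<Rightarrow> 'a \<Rightarrow> 'a" where
  "associator x y z = (x * y) * z - x * (y * z)"

typedef (overloaded) 'a center =
  "{z :: 'a::jordan_algebra.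
      \<forall>x y. associator x y z = 0 \<and> associator x z y = 0 \<and> associator z x y = 0}"
  morphisms center_val Abs_center
  by (intro exI[of _ 0]) (simp add: associator_def jordan_simps)

setup_lifting type_definition_center

instantiation center :: (jordan_algebra) real_vector
begin

lift_definition zero_center :: "'a center" is 0
  by (simp add: associator_def jordan_simps)

lift_definition plus_center :: "'a center \<Rightarrow> 'a center \<Rightarrow> 'a center" is "(+)"
  by (simp add: associator_def jordan_simps)

lift_definition uminus_center :: "'a center \<Rightarrow> 'a center" is uminus
  by (simp add: associator_def jordan_simps)

lift_definition minus_center :: "'a center \<Rightarrow> 'a center \<Rightarrow> 'a center" is "(-)"
  by (simp add: associator_def jordan_simps)

lift_definition scaleR_center :: "real \<Rightarrow> 'a center \<Rightarrow> 'a center" is scaleR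
  by (simp add: associator_def jordan_simps)

instance
  by standard (transfer; simp add: algebra_simps)+

end

typedef (overloaded) 'a derivation =
  "{X :: 'a::jordan_algebra \<Rightarrow> 'a. linear X \<and> (\<forall>x y. X (x * y) = X x * y + x * X y)}"
  morphisms derivation_apply Abs_derivation
  by (intro exI[of _ "\<lambda>_. 0"]) (simp add: linear_iff jordan_simps)

setup_lifting type_definition_derivation

instantiation derivation :: (jordan_algebra) real_vector
begin

lift_definition zero_derivation :: "'a derivation" is "\<lambda>_. 0"
  by (simp add: linear_iff jordan_simps)

lift_definition plus_derivation :: "'a derivation \<Rightarrow> 'a derivation \<Rightarrow> 'a derivation"
  is "\<lambda>X Y x. X x + Y x"
  by (simp add: linear_iff jordan_simps algebra_simps)

lift_definition uminus_derivation :: "'a derivation \<Rightarrow> 'a derivation" is "\<lambda>X x. - X x"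
  by (simp add: linear_iff jordan_simps algebra_simps)

lift_definition minus_derivation :: "'a derivation \<Rightarrow> 'a derivation \<Rightarrow> 'a derivation"
  is "\<lambda>X Y x. X x - Y x"
  by (simp add: linear_iff jordan_simps algebra_simps)

lift_definition scaleR_derivation :: "real \<Rightarrow> 'a derivation \<Rightarrow> 'a derivation"
  is "\<lambda>r X x. r *\<^sub>R X x"
  by (simp add: linear_iff jordan_simps algebra_simps)

instance
  by standard (transfer; simp add: fun_eq_iff algebra_simps)+

end

lemma center_times_derivation:
  fixes z :: "'a::jordan_algebra"
  assumes "\<And>x y. associator x y z = 0 \<and> associator x z y = 0 \<and> associator z x y = 0"
    and X: "linear X \<and> (\<forall>x y. X (x * y) = X x * y + x * X y)"
  shows "linear (\<lambda>x. z * X x) \<and> (\<forall>x y. z * X (x * y) = z * X x * y + x * (z * X y))"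
proof (intro conjI allI)
  have z: "z * (x * y) = (z * x) * y" "x * (z * y) = (x * z) * y" for x y
    using assms(1) by (simp_all add: associator_def)
  show "linear (\<lambda>x. z * X x)"
    using X by (simp add: linear_iff jordan_simps)
  fix x y
  have "z * (x * X y) = (z * x) * X y"
    by (rule z(1))
  also have "\<dots> = (x * z) * X y"
    by (simp only: jordan_commute[of z])
  also have "\<dots> = x * (z * X y)"
    by (simp only: z(2))
  finally show "z * X (x * y) = z * X x * y + x * (z * X y)"
    using X by (simp add: jordan_simps z(1))
qed

lift_definition center_scale_derivation ::
  "'a::jordan_algebra center \<Rightarrow> 'a derivation \<Rightarrow> 'a derivation"
  is "\<lambda>z X x. z * X x"
  by (rule center_times_derivation)


section \<open>Connections\<close>

text \<open>
  A \<open>J\<close>-module is given by a real vector space \<open>'m\<close> together with the action \<open>act\<close> of \<open>J\<close> on it.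
\<close>

definition connection ::
  "('j::jordan_algebra \<Rightarrow> 'm::real_vector \<Rightarrow> 'm) \<Rightarrow> ('j derivation \<Rightarrow> 'm endo) \<Rightarrow> bool" where
  "connection act nabla \<longleftrightarrow>
     linear nabla \<and>
     (\<forall>X x m. endo_apply (nabla X) (act x m) =
        act (derivation_apply X x) m + act x (endo_apply (nabla X) m)) \<and>
     (\<forall>z X m. endo_apply (nabla (center_scale_derivation z X)) m =
        act (center_val z) (endo_apply (nabla X) m))"

definition free_act ::
  "'j::jordan_algebra \<Rightarrow> ('j, 'e::real_vector) tensor_product \<Rightarrow> ('j, 'e) tensor_product" where
  "free_act y = tensor_lift (\<lambda>x e. (y * x) \<otimes> e)"

lemma bilinear_tensor_maps:
  assumes "linear f" "linear g"
  shows "bilinear (\<lambda>x e. f x \<otimes> g e)"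
  unfolding bilinear_def linear_iff
  by (simp add: linear_add[OF assms(1)] linear_add[OF assms(2)] linear_scale[OF assms(1)]
      linear_scale[OF assms(2)] bilinear_ladd[OF bilinear_tensor] bilinear_radd[OF bilinear_tensor]
      bilinear_lmul[OF bilinear_tensor] bilinear_rmul[OF bilinear_tensor])

lemma linear_jordan_times: "linear (\<lambda>x. y * x :: 'a::jordan_algebra)"
  by (simp add: linear_iff jordan_simps)

lemma
  shows linear_free_act: "linear (free_act y)"
    and free_act_tensor: "free_act y (x \<otimes> e) = (y * x) \<otimes> e"
  unfolding free_act_def
  using linear_tensor_lift[OF bilinear_tensor_maps[OF linear_jordan_times linear_id]]
    tensor_lift_tensor[OF bilinear_tensor_maps[OF linear_jordan_times linear_id]]
  by auto

lift_definition base_connection ::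
  "'j::jordan_algebra derivation \<Rightarrow> ('j, 'e::real_vector) tensor_product endo"
  is "\<lambda>X. tensor_lift (\<lambda>x e. X x \<otimes> e)"
  using linear_tensor_lift[OF bilinear_tensor_maps[OF _ linear_id]] by auto

lemma base_connection_tensor:
  "endo_apply (base_connection X) (x \<otimes> e) = derivation_apply X x \<otimes> e"
proof -
  have "linear (derivation_apply X)"
    using derivation_apply by blast
  from tensor_lift_tensor[OF bilinear_tensor_maps[OF this linear_id]] show ?thesis
    by (simp add: base_connection.rep_eq)
qed

text \<open>The operator \<open>x \<otimes> e \<mapsto> (z x) \<otimes> T e\<close>, first for a pair \<open>z, T\<close>, then for all of \<open>Z(J) \<otimes> End(E)\<close>.\<close>

lift_definition center_endo_op ::
  "'j::jordan_algebra center \<Rightarrow> 'e::real_vector endo \<Rightarrow> ('j, 'e) tensor_product endo"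
  is "\<lambda>z T. tensor_lift (\<lambda>x e. (z * x) \<otimes> T e)"
  using linear_tensor_lift[OF bilinear_tensor_maps[OF linear_jordan_times]] by blast

definition center_endo_act ::
  "('j::jordan_algebra center, 'e::real_vector endo) tensor_product
    \<Rightarrow> ('j, 'e) tensor_product endo" where
  "center_endo_act = tensor_lift center_endo_op"

lemma center_endo_op_tensor:
  "endo_apply (center_endo_op z T) (x \<otimes> e) = (center_val z * x) \<otimes> endo_apply T e"
  using tensor_lift_tensor[OF bilinear_tensor_maps[OF linear_jordan_times linear_endo_apply]]
  by (simp add: center_endo_op.rep_eq)

lemma endo_tensor_eqI:
  fixes f g :: "('a::real_vector, 'b::real_vector) tensor_product endo"
  assumes "\<And>x e. endo_apply f (x \<otimes> e) = endo_apply g (x \<otimes> e)"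
  shows "f = g"
  using tensor_eqI[OF linear_endo_apply linear_endo_apply assms] by (simp add: endo_apply_inject)

lemma bilinear_center_endo_op: "bilinear center_endo_op"
  unfolding bilinear_def linear_iff
  by (intro conjI allI; rule endo_tensor_eqI)
    (simp_all add: center_endo_op_tensor plus_endo.rep_eq scaleR_endo.rep_eq plus_center.rep_eq
      scaleR_center.rep_eq jordan_simps bilinear_ladd[OF bilinear_tensor]
      bilinear_radd[OF bilinear_tensor] bilinear_lmul[OF bilinear_tensor]
      bilinear_rmul[OF bilinear_tensor])

lemma linear_center_endo_act: "linear center_endo_act"
  unfolding center_endo_act_def by (rule linear_tensor_lift[OF bilinear_center_endo_op])

lemma center_endo_act_tensor:
  "endo_apply (center_endo_act (z \<otimes> T)) (x \<otimes> e) = (center_val z * x) \<otimes> endo_apply T e"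
  by (simp add: center_endo_act_def tensor_lift_tensor[OF bilinear_center_endo_op]
      center_endo_op_tensor)

end

theory Submission
  imports Defs
begin

text \<open>
  The Leibniz rule is the same for \<open>\<nabla>\<close> and for the base connection, so it cancels in the difference
  \<open>T = \<nabla>\<^sub>X - \<nabla>\<^sup>0\<^sub>X\<close>: this operator commutes with the action of \<open>J\<close>.  As \<open>J\<close> has a unit,
  \<open>x \<otimes> e\<close> is \<open>x\<close> acting on \<open>1 \<otimes> e\<close>, and \<open>T\<close> is determined by the vectors
  \<open>T (1 \<otimes> b)\<close>, \<open>b\<close> in a basis of \<open>E\<close>, i.e. by a matrix with entries in \<open>J\<close>.

  The entries are forced to be central.  A Jordan module is not associative, so letting first \<open>x\<close>
  and then \<open>y\<close> act differs in general from letting \<open>y x\<close> act.  On the vector \<open>1 \<otimes> e\<close> the two agree,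
  hence by commutation they agree on \<open>T (1 \<otimes> e)\<close> too, and each coordinate \<open>a\<close> of that vector
  satisfies \<open>(y x) a = y (x a)\<close>.  By commutativity this single associator identity already
  implies the other two that define the center (\<open>center_if_right_nuclear\<close>).  The matrix with
  central entries \<open>a\<^sub>b\<^sub>c\<close> is then the element \<open>\<Sum> a\<^sub>b\<^sub>c \<otimes> E\<^sub>b\<^sub>c\<close> of \<open>Z(J) \<otimes> End(E)\<close>,
  which acts as \<open>T\<close> and depends linearly on \<open>T\<close>, hence on \<open>X\<close>.
\<close>

lemma jordan_one_right: "x * 1 = (x :: 'j::unital_jordan_algebra)"
  by (metis jordan_commute jordan_one_left)

text \<open>
  Commutativity makes the associator antisymmetric in its outer arguments, and turns
  \<open>(x a) y\<close> and \<open>x (a y)\<close> into \<open>y (x a)\<close> and \<open>x (y a)\<close>, which the hypothesis makes equal to the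
  same element \<open>(x y) a\<close>.
\<close>

lemma center_if_right_nuclear:
  fixes a :: "'j::jordan_algebra"
  assumes "\<And>x y. (x * y) * a = x * (y * a)"
  shows "associator x y a = 0 \<and> associator x a y = 0 \<and> associator a x y = 0"
proof -
  have "(x * a) * y = y * (x * a)" and "x * (a * y) = x * (y * a)"
    by (simp_all only: jordan_commute)
  moreover have "y * (x * a) = x * (y * a)"
    by (metis assms jordan_commute)
  moreover have "(a * x) * y = y * (x * a)" and "a * (x * y) = (y * x) * a"
    by (metis jordan_commute)+
  ultimately show ?thesis
    by (simp add: associator_def assms)
qed

section \<open>Coordinates in a free module\<close>

definition contract ::
  "('e::real_vector \<Rightarrow> real) \<Rightarrow> ('j::real_vector, 'e) tensor_product \<Rightarrow> 'j" where
  "contract \<phi> = tensor_lift (\<lambda>x e. \<phi> e *\<^sub>R x)"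

lemma
  fixes \<phi> :: "'e::real_vector \<Rightarrow> real"
  assumes "linear \<phi>"
  shows linear_contract: "linear (contract \<phi> :: ('j::real_vector, 'e) tensor_product \<Rightarrow> 'j)"
    and contract_tensor: "contract \<phi> ((x :: 'j) \<otimes> e) = \<phi> e *\<^sub>R x"
proof -
  have "bilinear (\<lambda>(x::'j) e. \<phi> e *\<^sub>R x)"
    by (simp add: bilinear_def linear_iff linear_add[OF assms] linear_scale[OF assms]
        scaleR_add_left scaleR_add_right)
  then show "linear (contract \<phi> :: ('j, 'e) tensor_product \<Rightarrow> 'j)"
    and "contract \<phi> (x \<otimes> e) = \<phi> e *\<^sub>R x"
    unfolding contract_def by (simp_all only: linear_tensor_lift tensor_lift_tensor)
qed

lemma contract_free_act:
  assumes "linear \<phi>"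
  shows "contract \<phi> (free_act y t) = y * contract \<phi> t"
proof -
  have "contract \<phi> \<circ> free_act y = (*) y \<circ> contract \<phi>"
    by (rule tensor_eqI)
      (simp_all add: linear_compose linear_free_act linear_contract linear_jordan_times assms
        free_act_tensor contract_tensor jordan_simps)
  then show ?thesis
    by (simp add: fun_eq_iff)
qed

lemma finite_coordinates:
  assumes "\<exists>B. finite_dimensional_vector_space ((*\<^sub>R) :: real \<Rightarrow> 'e \<Rightarrow> 'e) B"
  obtains B :: "'e::real_vector set" and c :: "'e \<Rightarrow> 'e \<Rightarrow> real"
  where "\<And>b. linear (c b)" "\<And>e. e = (\<Sum>b\<in>B. c b e *\<^sub>R b)"
proof -
  obtain B where "finite_dimensional_vector_space ((*\<^sub>R) :: real \<Rightarrow> 'e \<Rightarrow> 'e) B"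
    using assms by blast
  then interpret E: finite_dimensional_vector_space "(*\<^sub>R) :: real \<Rightarrow> 'e \<Rightarrow> 'e" B .
  show thesis
  proof
    have B: "independent B" "span B = UNIV"
      using E.independent_Basis E.span_Basis by (simp_all add: dependent_raw_def span_raw_def)
    show "linear (\<lambda>e. representation B e b)" for b
      by (simp add: linear_iff real_vector.representation_add real_vector.representation_scale B)
    show "e = (\<Sum>b\<in>B. representation B e b *\<^sub>R b)" for e
      by (simp add: real_vector.sum_representation_eq B E.finite_Basis)
  qed
qed

lemma tensor_coordinates:
  fixes c :: "'e::real_vector \<Rightarrow> 'e \<Rightarrow> real" and t :: "('j::real_vector, 'e) tensor_product"
  assumes c: "\<And>b. linear (c b)" and expand: "\<And>e. e = (\<Sum>b\<in>B. c b e *\<^sub>R b)"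
  shows "t = (\<Sum>b\<in>B. contract (c b) t \<otimes> b)"
proof -
  let ?h = "\<lambda>t :: ('j, 'e) tensor_product. \<Sum>b\<in>B. contract (c b) t \<otimes> b"
  have "id = ?h"
  proof (rule tensor_eqI)
    show "linear ?h"
      by (intro linear_compose_sum ballI)
        (simp add: linear_iff linear_add[OF linear_contract[OF c]]
          linear_scale[OF linear_contract[OF c]] bilinear_ladd[OF bilinear_tensor]
          bilinear_lmul[OF bilinear_tensor])
    fix x :: 'j and e :: 'e
    have "x \<otimes> e = x \<otimes> (\<Sum>b\<in>B. c b e *\<^sub>R b)"
      by (subst expand[of e]) (rule refl)
    also have "\<dots> = (\<Sum>b\<in>B. x \<otimes> (c b e *\<^sub>R b))"
      using linear_sum[of "(\<otimes>) x"] bilinear_tensor by (auto simp: bilinear_def)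
    also have "\<dots> = ?h (x \<otimes> e)"
      by (simp add: contract_tensor[OF c] bilinear_lmul[OF bilinear_tensor]
          bilinear_rmul[OF bilinear_tensor])
    finally show "id (x \<otimes> e) = ?h (x \<otimes> e)"
      by simp
  qed (rule linear_id)
  then show ?thesis
    by (metis id_apply)
qed

section \<open>Endomorphisms that commute with the action\<close>

definition commutes_with_action ::
  "('j::jordan_algebra, 'e::real_vector) tensor_product endo \<Rightarrow> bool" where
  "commutes_with_action T \<longleftrightarrow>
     (\<forall>y t. endo_apply T (free_act y t) = free_act y (endo_apply T t))"

lemma commutes_with_action_tensor:
  fixes T :: "('j::unital_jordan_algebra, 'e::real_vector) tensor_product endo"
  assumes "commutes_with_action T"
  shows "endo_apply T (x \<otimes> e) = free_act x (endo_apply T (1 \<otimes> e))"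
  using assms unfolding commutes_with_action_def by (metis free_act_tensor jordan_one_right)

text \<open>
  \<open>T ((x y) \<otimes> e)\<close> can be computed from \<open>T (1 \<otimes> e)\<close> by acting with \<open>x y\<close>, or with \<open>y\<close> and then
  with \<open>x\<close>; comparing coordinates gives the hypothesis of \<open>center_if_right_nuclear\<close>.
\<close>

lemma entry_in_center:
  fixes T :: "('j::unital_jordan_algebra, 'e::real_vector) tensor_product endo"
    and e :: 'e
  assumes T: "commutes_with_action T" and \<phi>: "linear \<phi>"
  defines "a \<equiv> contract \<phi> (endo_apply T (1 \<otimes> e))"
  shows "associator x y a = 0 \<and> associator x a y = 0 \<and> associator a x y = 0"
proof (rule center_if_right_nuclear)
  fix x y :: 'j
  have "free_act (x * y) (endo_apply T (1 \<otimes> e)) = endo_apply T (free_act x (y \<otimes> e))"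
    by (simp add: commutes_with_action_tensor[OF T, of "x * y"] free_act_tensor)
  also have "\<dots> = free_act x (free_act y (endo_apply T (1 \<otimes> e)))"
    using T by (simp add: commutes_with_action_def commutes_with_action_tensor[OF T, of y])
  finally show "(x * y) * a = x * (y * a)"
    unfolding a_def by (metis contract_free_act[OF \<phi>])
qed

definition entry ::
  "('e \<Rightarrow> real) \<Rightarrow> 'e \<Rightarrow> ('j::unital_jordan_algebra, 'e::real_vector) tensor_product endo
    \<Rightarrow> 'j center" where
  "entry \<phi> e T = Abs_center (contract \<phi> (endo_apply T (1 \<otimes> e)))"

lemma center_val_entry:
  assumes "commutes_with_action T" "linear \<phi>"
  shows "center_val (entry \<phi> e T) = contract \<phi> (endo_apply T (1 \<otimes> e))"
  unfolding entry_def using entry_in_center[OF assms] by (simp add: Abs_center_inverse)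

text \<open>For \<open>\<phi>\<close> the coordinate along a basis vector \<open>d\<close>, this is the matrix unit \<open>E\<^sub>b\<^sub>d\<close>; the
  value for a nonlinear \<open>\<phi>\<close> is a mere default.\<close>

lift_definition rank_one :: "'e \<Rightarrow> ('e \<Rightarrow> real) \<Rightarrow> 'e::real_vector endo"
  is "\<lambda>b \<phi>. if linear \<phi> then (\<lambda>e. \<phi> e *\<^sub>R b) else (\<lambda>_. 0)"
  by (auto simp: linear_iff scaleR_add_left)

lemma rank_one_apply: "linear \<phi> \<Longrightarrow> endo_apply (rank_one b \<phi>) e = \<phi> e *\<^sub>R b"
  by (simp add: rank_one.rep_eq)

text \<open>The outer sum runs over the columns: the entries of column \<open>d\<close> are the coordinates of
  \<open>T (1 \<otimes> d)\<close>.\<close>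

definition center_matrix ::
  "'e set \<Rightarrow> ('e \<Rightarrow> 'e \<Rightarrow> real) \<Rightarrow> ('j::unital_jordan_algebra, 'e::real_vector) tensor_product endo
    \<Rightarrow> ('j center, 'e endo) tensor_product" where
  "center_matrix B c T = (\<Sum>d\<in>B. \<Sum>b\<in>B. entry (c b) d T \<otimes> rank_one b (c d))"

lemma endo_apply_sum: "endo_apply (\<Sum>i\<in>I. f i) t = (\<Sum>i\<in>I. endo_apply (f i) t)"
  using linear_sum[of "\<lambda>f. endo_apply f t" f I]
  by (simp add: linear_iff plus_endo.rep_eq scaleR_endo.rep_eq)

text \<open>
  Multiplying the coordinates of \<open>T (1 \<otimes> d)\<close> by \<open>x\<close> gives those of \<open>x\<close> acting on that vector,
  which is \<open>T (x \<otimes> d)\<close>; so the columns reassemble to \<open>T\<close>.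
\<close>

lemma center_matrix_acts:
  fixes T :: "('j::unital_jordan_algebra, 'e::real_vector) tensor_product endo"
  assumes T: "commutes_with_action T"
    and c: "\<And>b. linear (c b)" and expand: "\<And>e. e = (\<Sum>b\<in>B. c b e *\<^sub>R b)"
  shows "center_endo_act (center_matrix B c T) = T"
proof (rule endo_tensor_eqI)
  fix x :: 'j and e :: 'e
  have column: "(\<Sum>b\<in>B. (center_val (entry (c b) d T) * x) \<otimes> b) = endo_apply T (x \<otimes> d)" for d
  proof -
    have "contract (c b) (endo_apply T (x \<otimes> d)) = center_val (entry (c b) d T) * x" for b
      by (simp add: commutes_with_action_tensor[OF T, of x] contract_free_act[OF c]
          center_val_entry[OF T c] jordan_commute[of x])
    then show ?thesis
      using tensor_coordinates[of c B "endo_apply T (x \<otimes> d)", OF c expand] by simp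
  qed
  have "endo_apply (center_endo_act (center_matrix B c T)) (x \<otimes> e)
      = (\<Sum>d\<in>B. c d e *\<^sub>R (\<Sum>b\<in>B. (center_val (entry (c b) d T) * x) \<otimes> b))"
    by (simp add: center_matrix_def linear_sum[OF linear_center_endo_act] endo_apply_sum
        center_endo_act_tensor rank_one_apply[OF c] bilinear_rmul[OF bilinear_tensor]
        scaleR_sum_right)
  also have "\<dots> = (\<Sum>d\<in>B. c d e *\<^sub>R endo_apply T (x \<otimes> d))"
    by (simp only: column)
  also have "\<dots> = endo_apply T (x \<otimes> (\<Sum>d\<in>B. c d e *\<^sub>R d))"
  proof -
    have "linear ((\<otimes>) x :: 'e \<Rightarrow> _)"
      using bilinear_tensor by (auto simp: bilinear_def)
    then have lin: "linear (\<lambda>e. endo_apply T (x \<otimes> e))"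
      using linear_compose[OF _ linear_endo_apply] by (simp add: o_def)
    show ?thesis
      by (simp only: linear_sum[OF lin] linear_scale[OF lin])
  qed
  finally show "endo_apply (center_endo_act (center_matrix B c T)) (x \<otimes> e)
      = endo_apply T (x \<otimes> e)"
    using expand[of e] by simp
qed

text \<open>
  Linearity is stated along a family of operators because \<open>entry\<close> is only meaningful on operators
  that commute with the action.
\<close>

lemma linear_center_matrix:
  assumes D: "linear D" and commutes: "\<And>X. commutes_with_action (D X)"
    and c: "\<And>b. linear (c b)"
  shows "linear (\<lambda>X. center_matrix B c (D X))"
proof -
  have "linear (\<lambda>X. contract (c b) (endo_apply (D X) (1 \<otimes> d)))" for b d
    by (simp add: linear_iff linear_add[OF D] linear_scale[OF D] plus_endo.rep_eq
        scaleR_endo.rep_eq linear_add[OF linear_contract[OF c]]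
        linear_scale[OF linear_contract[OF c]])
  then have "linear (\<lambda>X. entry (c b) d (D X))" for b d
    by (simp add: linear_iff center_val_inject[symmetric] plus_center.rep_eq scaleR_center.rep_eq
        center_val_entry[OF commutes c])
  then show ?thesis
    unfolding center_matrix_def
    by (intro linear_compose_sum ballI)
      (simp add: linear_iff bilinear_ladd[OF bilinear_tensor] bilinear_lmul[OF bilinear_tensor])
qed

section \<open>The difference of a connection and the base connection\<close>

lemma linear_base_connection: "linear base_connection"
  unfolding linear_iff
  by (intro conjI allI; rule endo_tensor_eqI)
    (simp_all add: base_connection_tensor plus_endo.rep_eq scaleR_endo.rep_eq
      plus_derivation.rep_eq scaleR_derivation.rep_eq bilinear_ladd[OF bilinear_tensor]
      bilinear_lmul[OF bilinear_tensor])

lemma base_connection_leibniz: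
  fixes t :: "('j::jordan_algebra, 'e::real_vector) tensor_product"
  shows "endo_apply (base_connection X) (free_act x t)
    = free_act (derivation_apply X x) t + free_act x (endo_apply (base_connection X) t)"
proof -
  have X: "derivation_apply X (x * y) = derivation_apply X x * y + x * derivation_apply X y" for y
    using derivation_apply[of X] by blast
  have rhs: "linear (\<lambda>t :: ('j, 'e) tensor_product. free_act (derivation_apply X x) t
      + (free_act x \<circ> endo_apply (base_connection X)) t)"
    by (intro linear_compose_add linear_compose linear_free_act linear_endo_apply)
  have "endo_apply (base_connection X) \<circ> free_act x
      = (\<lambda>t :: ('j, 'e) tensor_product. free_act (derivation_apply X x) t
          + (free_act x \<circ> endo_apply (base_connection X)) t)"
    by (rule tensor_eqI)
      (use rhs in \<open>simp_all add: linear_compose linear_free_act linear_endo_apply free_act_tensor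
        base_connection_tensor X bilinear_ladd[OF bilinear_tensor]\<close>)
  then show ?thesis
    by (simp add: fun_eq_iff)
qed

lemma connection_difference_commutes:
  assumes "connection free_act nabla"
  shows "commutes_with_action (nabla X - base_connection X)"
  using assms
  by (simp add: connection_def commutes_with_action_def minus_endo.rep_eq base_connection_leibniz
      linear_diff[OF linear_free_act])

theorem proposition6p6:
  fixes nabla :: "'j::unital_jordan_algebra derivation \<Rightarrow> ('j, 'e::real_vector) tensor_product endo"
  assumes "\<exists>B. finite_dimensional_vector_space ((*\<^sub>R) :: real \<Rightarrow> 'j \<Rightarrow> 'j) B"
    and "\<exists>B. finite_dimensional_vector_space ((*\<^sub>R) :: real \<Rightarrow> 'e \<Rightarrow> 'e) B"
    and "connection free_act nabla"
  shows "\<exists>\<A> :: 'j derivation \<Rightarrow> ('j center, 'e endo) tensor_product.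
    linear \<A> \<and> (\<forall>X. nabla X = base_connection X + center_endo_act (\<A> X))"
proof -
  obtain B :: "'e set" and c where c: "\<And>b. linear (c b)"
    and expand: "\<And>e. e = (\<Sum>b\<in>B. c b e *\<^sub>R b)"
    using finite_coordinates[OF assms(2)] by metis
  let ?D = "\<lambda>X. nabla X - base_connection X"
  have commutes: "commutes_with_action (?D X)" for X
    by (rule connection_difference_commutes[OF assms(3)])
  have "linear nabla"
    using assms(3) by (simp add: connection_def)
  then have "linear ?D"
    by (rule linear_compose_sub[OF _ linear_base_connection])
  then have "linear (\<lambda>X. center_matrix B c (?D X))"
    using commutes c by (rule linear_center_matrix)
  moreover have "nabla X = base_connection X + center_endo_act (center_matrix B c (?D X))" for X
    using center_matrix_acts[OF commutes[of X] c expand] by simp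
  ultimately show ?thesis
    by blast
qed

end
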